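(* Let $X,Y$ be real Hilbert spaces and $F:X\to Y$ a bounded linear operator. For $N\in\mathbb N$ and $y\in Y$ let $u_N=u_N(y)\in X$ be the iterate defined in the context. Then the mapping $y\mapsto u_N$ is a regularization operator for the equation $Fu=y$, as $N\to\infty$.
   Context: Definition of $u_N$. For fixed $N\in\mathbb N$ define operators by $S_N:=I$ and, for $k=N-1,\dots,0$, $$K_k:=(F^*S_{k+1}F+I)^{-1}F^*S_{k+1},\qquad S_k:=(I-FK_k)^*S_{k+1}(I-FK_k)+K_k^*K_k+I .$$ For $y\in Y$ set $\epsilon_0:=-y$ and, for $k=0,\dots,N-1$, $$v_k:=-K_k\epsilon_k,\qquad \epsilon_{k+1}:=\epsilon_k+Fv_k ,$$ and let $u_N:=\sum_{j=0}^{N-1}v_j$. (Equivalently, the iteration $u_{k+1}=u_k+v_k$ with $u_0=0$; all quantities depend on $N$.) Regularization operator: let $F^\dagger$ denote the Moore–Penrose inverse of $F$ with domain $\mathcal D(F^\dagger)=\mathcal R(F)\oplus\mathcal R(F)^\perp$. A family of continuous maps $R_N:Y\to X$, $N\in\mathbb N$, is a regularization operator (as $N\to\infty$) if for every $y\in\mathcal D(F^\dagger)$ there is a parameter choice rule $N=N(\delta,y_\delta)$ such that, as $\delta\to0$, $$\sup\{\|R_{N(\delta,y_\delta)}(y_\delta)-F^\dagger y\| : y_\delta\in Y,\ \|y_\delta-y\|\le\delta\}\to0$$ and $\inf\{N(\delta,y_\delta): y_\delta\in Y,\ \|y_\delta-y\|\le\delta\}\to\infty$. *)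

theory Defs
  imports "HOL-Analysis.Analysis"
begin

text \<open>
  Operators are plain functions, \<^const>\<open>adjoint\<close> is the Hilbert space adjoint, and
  \<^const>\<open>inv\<close> the inverse on the whole space. For bounded \<open>F\<close> and \<open>S\<close> positive semidefinite
  and self-adjoint, the operator inverted below is a bijection, so no junk values occur.
\<close>

definition gain :: "('x::real_inner \<Rightarrow> 'y::real_inner) \<Rightarrow> ('y \<Rightarrow> 'y) \<Rightarrow> 'y \<Rightarrow> 'x" where
  "gain F S = inv (\<lambda>x. adjoint F (S (F x)) + x) \<circ> adjoint F \<circ> S"

definition riccati_step :: "('x::real_inner \<Rightarrow> 'y::real_inner) \<Rightarrow> ('y \<Rightarrow> 'y) \<Rightarrow> 'y \<Rightarrow> 'y" where
  "riccati_step F S =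
     (let K = gain F S; M = (\<lambda>e. e - F (K e))
      in (\<lambda>e. adjoint M (S (M e)) + adjoint K (K e) + e))"

text \<open>Backward recursion in \<open>k\<close>, started at the horizon \<open>N\<close>; the value for \<open>k > N\<close> is irrelevant.\<close>

function riccati :: "('x::real_inner \<Rightarrow> 'y::real_inner) \<Rightarrow> nat \<Rightarrow> nat \<Rightarrow> 'y \<Rightarrow> 'y" where
  "riccati F N k = (if k < N then riccati_step F (riccati F N (Suc k)) else id)"
  by pat_completeness auto
termination by (relation "Wellfounded.measure (\<lambda>(F, N, k). N - k)") auto

declare riccati.simps [simp del]

definition gain_at :: "('x::real_inner \<Rightarrow> 'y::real_inner) \<Rightarrow> nat \<Rightarrow> nat \<Rightarrow> 'y \<Rightarrow> 'x" where
  "gain_at F N k = gain F (riccati F N (Suc k))"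

primrec out_error :: "('x::real_inner \<Rightarrow> 'y::real_inner) \<Rightarrow> nat \<Rightarrow> 'y \<Rightarrow> nat \<Rightarrow> 'y" where
  "out_error F N y 0 = - y"
| "out_error F N y (Suc k) = out_error F N y k + F (- gain_at F N k (out_error F N y k))"

definition control :: "('x::real_inner \<Rightarrow> 'y::real_inner) \<Rightarrow> nat \<Rightarrow> 'y \<Rightarrow> nat \<Rightarrow> 'x" where
  "control F N y k = - gain_at F N k (out_error F N y k)"

definition final_iterate :: "('x::real_inner \<Rightarrow> 'y::real_inner) \<Rightarrow> nat \<Rightarrow> 'y \<Rightarrow> 'x" where
  "final_iterate F N y = (\<Sum>j<N. control F N y j)"

definition mp_domain :: "('x::real_inner \<Rightarrow> 'y::real_inner) \<Rightarrow> 'y set" where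
  "mp_domain F = {a + b | a b. a \<in> range F \<and> b \<in> (range F)\<^sup>\<bottom>}"

text \<open>
  The Moore--Penrose inverse is the linear extension to \<^term>\<open>mp_domain F\<close>, vanishing on
  \<open>(range F)\<^sup>\<bottom>\<close>, of the inverse of the bijection from \<open>(ker F)\<^sup>\<bottom>\<close> to \<open>range F\<close> given by \<open>F\<close>.
  So \<open>y\<close> is sent to the inverse image of its component in \<open>range F\<close>. The value outside
  \<^term>\<open>mp_domain F\<close> is unspecified.
\<close>

definition mp_inverse :: "('x::real_inner \<Rightarrow> 'y::real_inner) \<Rightarrow> 'y \<Rightarrow> 'x" where
  "mp_inverse F y =
     the_inv_into ({x. F x = 0}\<^sup>\<bottom>) F (THE a. a \<in> range F \<and> y - a \<in> (range F)\<^sup>\<bottom>)"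

text \<open>
  The parameter choice rule may depend on \<open>y\<close>. The supremum is taken in \<^typ>\<open>ereal\<close> since it
  may be infinite.
\<close>

definition regularization_operator ::
  "('x::real_inner \<Rightarrow> 'y::real_inner) \<Rightarrow> (nat \<Rightarrow> 'y \<Rightarrow> 'x) \<Rightarrow> bool" where
  "regularization_operator F R \<longleftrightarrow>
     (\<forall>N. continuous_on UNIV (R N)) \<and>
     (\<forall>y\<in>mp_domain F. \<exists>rule :: real \<Rightarrow> 'y \<Rightarrow> nat.
        ((\<lambda>\<delta>. SUP z\<in>cball y \<delta>. ereal (norm (R (rule \<delta> z) z - mp_inverse F y)))
            \<longlongrightarrow> 0) (at_right 0) \<and>
        filterlim (\<lambda>\<delta>. INF z\<in>cball y \<delta>. rule \<delta> z) at_top (at_right 0))"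

end

theory Submission
  imports Defs
begin

text \<open>
  Every Riccati operator \<open>S\<close> satisfies \<open>S \<ge> I\<close>, is self-adjoint and commutes with \<open>F F\<^sup>*\<close>. For
  exact data \<open>y = F x\<close> the errors \<open>e\<^sub>k = x - u\<^sub>k\<close> obey \<open>e\<^sub>k = (I + F\<^sup>* S\<^bsub>k+1\<^esub> F) e\<^bsub>k+1\<^esub>\<close>, so that
  \<open>\<parallel>e\<^bsub>k+1\<^esub>\<parallel>\<^sup>2 + 2 \<parallel>F e\<^bsub>k+1\<^esub>\<parallel>\<^sup>2 \<le> \<parallel>e\<^sub>k\<parallel>\<^sup>2\<close>: the errors decrease in norm and
  \<open>\<Sum>\<parallel>F e\<^sub>k\<parallel>\<^sup>2\<close> is bounded by \<open>\<parallel>x\<parallel>\<^sup>2\<close>, uniformly in \<open>N\<close>.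
  If \<open>x = F\<^sup>* F z\<close>, commutation gives \<open>e\<^sub>k(x) = F\<^sup>* F e\<^sub>k(z)\<close>, hence \<open>\<parallel>e\<^sub>N(x)\<parallel>\<^sup>2 = O(1/N)\<close>. Since the
  range of \<open>F\<^sup>* F\<close> is dense in \<open>(ker F)\<^sup>\<bottom>\<close> and \<open>x \<mapsto> e\<^sub>N(x)\<close> is a contraction, \<open>u\<^sub>N\<close> converges to
  \<open>F\<^sup>\<dagger> y\<close> for all \<open>y\<close> in the domain of \<open>F\<^sup>\<dagger>\<close>. Pointwise convergence of bounded linear maps yields a
  regularization operator, with an a priori rule \<open>N(\<delta>)\<close> that grows so slowly that
  \<open>\<delta> \<parallel>R\<^bsub>N(\<delta>)\<^esub>\<parallel>\<close> tends to \<open>0\<close>.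
\<close>

section \<open>Projections, adjoints and coercive operators in Hilbert spaces\<close>

lemma subspace_closure:
  fixes W :: "'a::real_normed_vector set"
  assumes "subspace W"
  shows "subspace (closure W)"
proof (rule subspaceI)
  show "0 \<in> closure W"
    using subspace_0[OF assms] closure_subset by blast
  show "x + y \<in> closure W" if x: "x \<in> closure W" and y: "y \<in> closure W" for x y
  proof -
    obtain f g where "\<And>n. f n \<in> W" "f \<longlonglongrightarrow> x" "\<And>n. g n \<in> W" "g \<longlonglongrightarrow> y"
      using x y unfolding closure_sequential by blast
    then show ?thesis
      unfolding closure_sequential
      by (intro exI[of _ "\<lambda>n. f n + g n"]) (auto intro: tendsto_add subspace_add[OF assms])
  qed
  show "c *\<^sub>R x \<in> closure W" if x: "x \<in> closure W" for c x
  proof -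
    obtain f where "\<And>n. f n \<in> W" "f \<longlonglongrightarrow> x"
      using x unfolding closure_sequential by blast
    then show ?thesis
      unfolding closure_sequential
      by (intro exI[of _ "\<lambda>n. c *\<^sub>R f n"])
        (auto intro: tendsto_scaleR subspace_scale[OF assms])
  qed
qed

text \<open>By the parallelogram law, the near-minimizers \<open>C n\<close> have diameters tending
  to 0, because midpoints stay in \<open>W\<close> and so keep distance at least \<open>d\<close>.
  Completeness makes the nested sets meet in one point.\<close>

lemma closed_subspace_nearest_point:
  fixes W :: "'a::{real_inner,banach} set"
  assumes W: "subspace W" "closed W"
  obtains p where "p \<in> W" "\<And>w. w \<in> W \<Longrightarrow> norm (x - p) \<le> norm (x - w)"
proof -
  define d where "d = infdist x W"
  define C where "C n = W \<inter> cball x (d + 1 / Suc n)" for n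
  have ne: "W \<noteq> {}" using subspace_0[OF W(1)] by auto
  have dle: "d \<le> dist x w" if "w \<in> W" for w
    unfolding d_def using that by (rule infdist_le)
  have d0: "d \<ge> 0" unfolding d_def by (rule infdist_nonneg)
  have diam: "(dist a b)\<^sup>2 \<le> 4 * (2 * d + 1) / Suc n" if "a \<in> C n" "b \<in> C n" for a b n
  proof -
    have ab: "a \<in> W" "b \<in> W" "dist x a \<le> d + 1 / Suc n" "dist x b \<le> d + 1 / Suc n"
      using that by (auto simp: C_def)
    have "(1/2) *\<^sub>R (a + b) \<in> W"
      using W(1) ab by (intro subspace_mul subspace_add)
    then have "d \<le> norm (x - (1/2) *\<^sub>R (a + b))"
      using dle by (simp add: dist_norm)
    then have mid: "d\<^sup>2 \<le> (norm (x - (1/2) *\<^sub>R (a + b)))\<^sup>2"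
      using d0 by (rule power_mono)
    have "(dist a b)\<^sup>2 = 2 * (dist x a)\<^sup>2 + 2 * (dist x b)\<^sup>2
        - 4 * (norm (x - (1/2) *\<^sub>R (a + b)))\<^sup>2"
    proof -
      have "(x - a) + (x - b) = 2 *\<^sub>R (x - (1/2) *\<^sub>R (a + b))"
        by (simp add: scaleR_diff_right scaleR_2)
      then have "norm ((x - a) + (x - b)) = 2 * norm (x - (1/2) *\<^sub>R (a + b))"
        by simp
      moreover have "(norm (u + v))\<^sup>2 + (norm (u - v))\<^sup>2 = 2 * (norm u)\<^sup>2 + 2 * (norm v)\<^sup>2"
        for u v :: 'a
        unfolding power2_norm_eq_inner by (simp add: inner_add inner_diff)
      from this[of "x - a" "x - b"]
      have "(norm ((x - a) + (x - b)))\<^sup>2 + (dist a b)\<^sup>2 = 2 * (dist x a)\<^sup>2 + 2 * (dist x b)\<^sup>2"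
        by (simp only: dist_norm diff_diff_eq2 norm_minus_commute) simp
      ultimately show ?thesis by (simp add: power_mult_distrib)
    qed
    also have "\<dots> \<le> 2 * (d + 1 / Suc n)\<^sup>2 + 2 * (d + 1 / Suc n)\<^sup>2 - 4 * d\<^sup>2"
      using mid power_mono[OF ab(3), of 2] power_mono[OF ab(4), of 2] by simp
    also have "\<dots> = 4 * (2 * d + 1 / Suc n) * (1 / Suc n)"
      by (simp add: power2_eq_square algebra_simps)
    also have "\<dots> \<le> 4 * (2 * d + 1) * (1 / Suc n)"
      by (intro mult_right_mono mult_left_mono add_left_mono) auto
    finally show ?thesis by simp
  qed
  have "\<exists>p. \<Inter>(range C) = {p}"
  proof (rule decreasing_closed_nest_sing)
    show "closed (C n)" for n unfolding C_def by (intro closed_Int W closed_cball)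
    show "C n \<noteq> {}" for n
    proof -
      have "infdist x W < d + 1 / Suc n" by (simp add: d_def)
      then obtain w where "w \<in> W" "dist x w < d + 1 / Suc n"
        using ne bdd_below_image_dist by (auto simp: infdist_notempty cINF_less_iff)
      then show ?thesis by (auto simp: C_def intro: less_imp_le)
    qed
    show "C n \<subseteq> C m" if "m \<le> n" for m n
    proof -
      have "1 / real (Suc n) \<le> 1 / Suc m" using that by (simp add: frac_le)
      then show ?thesis by (auto simp: C_def)
    qed
    show "\<exists>n. \<forall>a\<in>C n. \<forall>b\<in>C n. dist a b < e" if "e > 0" for e
    proof -
      obtain n where "4 * (2 * d + 1) / e\<^sup>2 < real n" using reals_Archimedean2 by blast
      then have "4 * (2 * d + 1) / e\<^sup>2 < Suc n" by simp
      then have "4 * (2 * d + 1) < real (Suc n) * e\<^sup>2"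
        using that by (subst (asm) pos_divide_less_eq) auto
      then have "4 * (2 * d + 1) / Suc n < e\<^sup>2"
        by (subst pos_divide_less_eq) (auto simp: mult.commute)
      then have "(dist a b)\<^sup>2 < e\<^sup>2" if "a \<in> C n" "b \<in> C n" for a b
        by (rule le_less_trans[OF diam[OF that]])
      then have "dist a b < e" if "a \<in> C n" "b \<in> C n" for a b
        by (meson that \<open>e > 0\<close> less_imp_le power_less_imp_less_base)
      then show ?thesis by blast
    qed
  qed
  then obtain p where "\<Inter>(range C) = {p}" by blast
  then have p: "p \<in> C n" for n by auto
  have "dist x p \<le> d + inverse (Suc n)" for n
    using p[of n] by (simp add: C_def inverse_eq_divide)
  moreover have "(\<lambda>n. d + inverse (real (Suc n))) \<longlonglongrightarrow> d + 0"
    by (intro tendsto_intros LIMSEQ_inverse_real_of_nat)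
  ultimately have "dist x p \<le> d" by (intro LIMSEQ_le_const[where X="\<lambda>n. d + inverse (real (Suc n))"]) auto
  then show thesis
    using p[of 0] order_trans[OF _ dle] by (intro that[of p]) (auto simp: C_def dist_norm)
qed

lemma orthogonal_projection_exists:
  fixes W :: "'a::{real_inner,banach} set"
  assumes W: "subspace W" "closed W"
  obtains p where "p \<in> W" "x - p \<in> W\<^sup>\<bottom>"
proof -
  obtain p where p: "p \<in> W" "\<And>w. w \<in> W \<Longrightarrow> norm (x - p) \<le> norm (x - w)"
    using closed_subspace_nearest_point[OF W] by blast
  have "w \<bullet> (x - p) = 0" if w: "w \<in> W" for w
  proof (cases "w = 0")
    case False
    \<comment> \<open>\<open>t\<close> minimizes the quadratic
      \<open>norm (x - p - t *\<^sub>R w)\<close> squared; a nonzero inner product would bring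
      \<open>p + t *\<^sub>R w\<close> strictly closer to \<open>x\<close>.\<close>
    define t where "t = (w \<bullet> (x - p)) / (w \<bullet> w)"
    have "p + t *\<^sub>R w \<in> W" using p w W by (intro subspace_add subspace_mul)
    from p(2)[OF this] have "(norm (x - p))\<^sup>2 \<le> (norm (x - p - t *\<^sub>R w))\<^sup>2"
      by (intro power_mono) (simp_all add: diff_diff_eq)
    also have "\<dots> = (norm (x - p))\<^sup>2 - 2 * (t * (w \<bullet> (x - p))) + t * (t * (w \<bullet> w))"
      by (simp only: power2_norm_eq_inner) (simp add: inner_diff_left inner_diff_right inner_commute)
    also have "t * (w \<bullet> w) = w \<bullet> (x - p)" using False by (simp add: t_def)
    finally have "t * (w \<bullet> (x - p)) \<le> 0" by simp
    then have "(w \<bullet> (x - p))\<^sup>2 / (w \<bullet> w) \<le> 0" by (simp add: t_def power2_eq_square)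
    moreover have "w \<bullet> w > 0" using False by simp
    ultimately show ?thesis by (simp add: divide_le_0_iff)
  qed simp
  then show thesis using p(1) that[of p] by (auto simp: orthogonal_comp_def orthogonal_def)
qed

text \<open>The residual of the projection onto \<open>closure W\<close> is orthogonal both to
  \<open>p\<close> and to \<open>x\<close>, hence to itself.\<close>

lemma orthogonal_comp_double_closure:
  fixes W :: "'a::{real_inner,banach} set"
  assumes "subspace W" "x \<in> W\<^sup>\<bottom>\<^sup>\<bottom>"
  shows "x \<in> closure W"
proof -
  obtain p where p: "p \<in> closure W" "x - p \<in> (closure W)\<^sup>\<bottom>"
    using orthogonal_projection_exists[OF subspace_closure[OF assms(1)] closed_closure] by blast
  then have "p \<bullet> (x - p) = 0" by (auto simp: orthogonal_comp_def orthogonal_def)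
  moreover have "x - p \<in> W\<^sup>\<bottom>" using p(2) closure_subset by (force simp: orthogonal_comp_def)
  then have "x \<bullet> (x - p) = 0"
    using assms(2) by (subst inner_commute) (auto simp: orthogonal_comp_def orthogonal_def)
  ultimately have "(x - p) \<bullet> (x - p) = 0" by (simp add: inner_diff_left)
  then show ?thesis using p(1) by simp
qed

lemma closed_zero_set:
  assumes "bounded_linear f"
  shows "closed {x. f x = 0}"
  using assms by (intro closed_Collect_eq linear_continuous_on continuous_on_const)

lemma subspace_zero_set:
  assumes "linear f"
  shows "subspace {x. f x = 0}"
  using linear_subspace_vimage[OF assms subspace_single_0] by (simp add: vimage_def)

lemma Riesz_representation:
  fixes g :: "'a::{real_inner,banach} \<Rightarrow> real"
  assumes g: "bounded_linear g"
  obtains r where "\<And>x. g x = x \<bullet> r"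
proof (cases "\<forall>x. g x = 0")
  case True
  then show thesis using that[of 0] by simp
next
  case False
  interpret g: bounded_linear g by fact
  obtain x where x: "g x \<noteq> 0" using False by blast
  obtain p where p: "g p = 0" "x - p \<in> {x. g x = 0}\<^sup>\<bottom>"
    using orthogonal_projection_exists[OF subspace_zero_set[OF g.linear_axioms] closed_zero_set[OF g]]
    by blast
  define z where "z = x - p"
  have gz: "g z \<noteq> 0" using x p by (simp add: z_def g.diff)
  then have z: "z \<bullet> z \<noteq> 0" using g.zero by auto
  have orth: "y \<bullet> z = 0" if "g y = 0" for y
    using p(2) that by (auto simp: z_def orthogonal_comp_def orthogonal_def)
  have "g y = y \<bullet> ((g z / (z \<bullet> z)) *\<^sub>R z)" for y
  proof -
    \<comment> \<open>The kernel of \<open>g\<close> has codimension one: subtracting this multiple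
      of \<open>z\<close> moves any \<open>y\<close> into it.\<close>
    have "(y - (g y / g z) *\<^sub>R z) \<bullet> z = 0"
      using gz by (intro orth) (simp add: g.diff g.scaleR)
    then have "y \<bullet> z = (g y / g z) * (z \<bullet> z)" by (simp add: inner_diff_left)
    then show ?thesis using gz z by simp
  qed
  then show thesis by (rule that)
qed

text \<open>\<open>adjoint\<close> is a Hilbert choice, so its defining identity needs an existence
  proof; Riesz representation of \<open>F x \<bullet> y\<close> in \<open>x\<close> provides
  it.\<close>

lemma adjoint_inner:
  fixes F :: "'x::{real_inner,banach} \<Rightarrow> 'y::real_inner"
  assumes "bounded_linear F"
  shows "F x \<bullet> y = x \<bullet> adjoint F y"
proof -
  have "\<exists>r. \<forall>x. F x \<bullet> y = x \<bullet> r" for y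
  proof -
    have "bounded_linear (\<lambda>x. F x \<bullet> y)"
      by (intro bounded_linear_compose[OF bounded_linear_inner_left assms])
    then show ?thesis using Riesz_representation by metis
  qed
  then have "\<exists>G. \<forall>x y. F x \<bullet> y = x \<bullet> G y" by metis
  then have "\<forall>x y. F x \<bullet> y = x \<bullet> adjoint F y"
    unfolding adjoint_def by (rule someI_ex)
  then show ?thesis by blast
qed

lemma bounded_linear_adjoint:
  fixes F :: "'x::{real_inner,banach} \<Rightarrow> 'y::real_inner"
  assumes F: "bounded_linear F"
  shows "bounded_linear (adjoint F)"
proof -
  interpret F: bounded_linear F by fact
  note adj = adjoint_inner[OF F, symmetric]
  obtain B where B: "0 < B" "\<And>x. norm (F x) \<le> norm x * B" using F.pos_bounded by blast
  show ?thesis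
  proof (rule bounded_linear_intro)
    show "adjoint F (a + b) = adjoint F a + adjoint F b" for a b
      by (rule vector_eq_ldot[THEN iffD1]) (simp add: adj inner_add_right)
    show "adjoint F (c *\<^sub>R a) = c *\<^sub>R adjoint F a" for c a
      by (rule vector_eq_ldot[THEN iffD1]) (simp add: adj)
    show "norm (adjoint F y) \<le> norm y * B" for y
    proof (cases "adjoint F y = 0")
      case False
      have "norm (adjoint F y) * norm (adjoint F y) = F (adjoint F y) \<bullet> y"
        by (simp only: adjoint_inner[OF F] power2_eq_square[symmetric] power2_norm_eq_inner)
      also have "\<dots> \<le> norm (F (adjoint F y)) * norm y" by (rule norm_cauchy_schwarz)
      also have "\<dots> \<le> norm (adjoint F y) * B * norm y" by (intro mult_right_mono B) auto
      finally have "norm (adjoint F y) * norm (adjoint F y) \<le> norm (adjoint F y) * (norm y * B)"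
        by (simp add: mult_ac)
      then show ?thesis using False by simp
    qed (use B in auto)
  qed
qed

text \<open>Lax-Milgram with constant 1. The lower bound gives injectivity and a closed range; a
  vector orthogonal to the range is orthogonal to its own image, hence 0 by coercivity.\<close>

lemma coercive_imp_bij:
  fixes T :: "'a::{real_inner,banach} \<Rightarrow> 'a"
  assumes T: "bounded_linear T" and coercive: "\<And>x. x \<bullet> x \<le> T x \<bullet> x"
  shows "bij T" and "norm x \<le> norm (T x)"
proof -
  interpret T: bounded_linear T by fact
  show lower: "norm x \<le> norm (T x)" for x
  proof (cases "x = 0")
    case False
    have "norm x * norm x \<le> norm (T x) * norm x"
      using coercive[of x] norm_cauchy_schwarz[of "T x" x]
      by (simp flip: power2_eq_square add: power2_norm_eq_inner)
    then show ?thesis using False by simp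
  qed simp
  have "inj T"
    unfolding linear_injective_0[OF T.linear_axioms] using lower
    by (metis norm_le_zero_iff norm_zero)
  moreover have "z \<in> range T" for z
  proof -
    have "closed (range T)"
      using complete_isometric_image[of 1 UNIV T] lower T
      by (simp add: complete_imp_closed complete_UNIV)
    then obtain p where p: "p \<in> range T" "z - p \<in> (range T)\<^sup>\<bottom>"
      using orthogonal_projection_exists linear_subspace_image[OF T.linear_axioms subspace_UNIV]
      by metis
    have "T (z - p) \<bullet> (z - p) = 0"
      using p(2) by (auto simp: orthogonal_comp_def orthogonal_def)
    then have "(z - p) \<bullet> (z - p) = 0"
      using coercive[of "z - p"] inner_ge_zero[of "z - p"] by simp
    then show ?thesis using p(1) by simp
  qed
  ultimately show "bij T" by (auto simp: bij_def)
qed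

section \<open>Riccati operators\<close>

text \<open>The invariant of the backward recursion. The lower bound makes the gains well defined
  and yields the energy estimate; the commutation clause lets the error iteration commute with
  \<open>adjoint F\<close> after \<open>F\<close>.\<close>

definition admissible :: "('x::real_inner \<Rightarrow> 'y::real_inner) \<Rightarrow> ('y \<Rightarrow> 'y) \<Rightarrow> bool" where
  "admissible F S \<longleftrightarrow> bounded_linear S \<and> (\<forall>a b. S a \<bullet> b = a \<bullet> S b) \<and>
     (\<forall>a. a \<bullet> a \<le> S a \<bullet> a) \<and> (\<forall>a. S (F (adjoint F a)) = F (adjoint F (S a)))"

lemma admissible_id: "admissible F id"
  by (simp add: admissible_def id_def bounded_linear_ident)

locale admissible_weight =
  fixes F :: "'x::{real_inner,banach} \<Rightarrow> 'y::{real_inner,banach}" and S :: "'y \<Rightarrow> 'y"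
  assumes F: "bounded_linear F" and S: "admissible F S"
begin

sublocale F: bounded_linear F by (rule F)
sublocale F': bounded_linear "adjoint F" by (rule bounded_linear_adjoint[OF F])
sublocale S: bounded_linear S using S by (simp add: admissible_def)

text \<open>The operator inverted in \<open>gain\<close>. It is coercive even if \<open>F\<close>
  has a kernel, so \<open>inv\<close> is a true inverse.\<close>

definition H :: "'x \<Rightarrow> 'x" where "H x = adjoint F (S (F x)) + x"

lemma S_sym: "S a \<bullet> b = a \<bullet> S b"
  and S_ge: "a \<bullet> a \<le> S a \<bullet> a"
  and S_commute: "S (F (adjoint F a)) = F (adjoint F (S a))"
  using S by (auto simp: admissible_def)

lemma inner_adjoint: "adjoint F y \<bullet> x = y \<bullet> F x"
  by (metis adjoint_inner[OF F] inner_commute)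

lemma bounded_linear_H: "bounded_linear H"
  unfolding H_def
  by (intro bounded_linear_add bounded_linear_ident bounded_linear_compose[OF F'.bounded_linear_axioms]
      bounded_linear_compose[OF S.bounded_linear_axioms] F)

sublocale H: bounded_linear H by (rule bounded_linear_H)

lemma H_inner: "(norm x)\<^sup>2 + (norm (F x))\<^sup>2 \<le> H x \<bullet> x"
  using S_ge[of "F x"] by (simp add: H_def inner_add_left inner_adjoint power2_norm_eq_inner)

lemma H_coercive: "x \<bullet> x \<le> H x \<bullet> x"
  using H_inner[of x] zero_le_power2[of "norm (F x)"]
  unfolding power2_norm_eq_inner[of x] by linarith

lemmas bij_H = coercive_imp_bij(1)[OF bounded_linear_H H_coercive]
  and norm_le_H = coercive_imp_bij(2)[OF bounded_linear_H H_coercive]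

text \<open>Used from right to left: identities for \<open>gain F S\<close> are checked after
  applying \<open>H\<close> to both sides.\<close>

lemma H_eq_iff: "H x = H y \<longleftrightarrow> x = y"
  using bij_H by (simp add: bij_def inj_eq)

lemma H_gain: "H (gain F S e) = adjoint F (S e)"
proof -
  have "gain F S e = inv H (adjoint F (S e))"
    by (simp add: gain_def H_def[abs_def])
  then show ?thesis
    using bij_H by (simp only: bij_def surj_f_inv_f)
qed

lemma H_commute: "H (adjoint F (F x)) = adjoint F (F (H x))"
  by (simp add: H_def F'.add F.add S_commute)

lemma bounded_linear_gain: "bounded_linear (gain F S)"
proof -
  have FS: "bounded_linear (\<lambda>e. adjoint F (S e))"
    by (intro bounded_linear_compose[OF F'.bounded_linear_axioms] S.bounded_linear_axioms)
  then obtain B where B: "\<And>e. norm (adjoint F (S e)) \<le> norm e * B"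
    using bounded_linear.bounded by blast
  show ?thesis
  proof (rule bounded_linear_intro)
    show "gain F S (a + b) = gain F S a + gain F S b" for a b
      by (simp add: H_gain H.add S.add F'.add flip: H_eq_iff)
    show "gain F S (c *\<^sub>R a) = c *\<^sub>R gain F S a" for c a
      by (simp add: H_gain H.scaleR S.scaleR F'.scaleR flip: H_eq_iff)
    show "norm (gain F S e) \<le> norm e * B" for e
      using norm_le_H[of "gain F S e"] B[of e] by (simp add: H_gain)
  qed
qed

sublocale K': bounded_linear "adjoint (gain F S)" by (rule bounded_linear_adjoint[OF bounded_linear_gain])

lemma gain_commute: "gain F S (F (adjoint F e)) = adjoint F (F (gain F S e))"
  by (simp add: H_gain S_commute H_commute flip: H_eq_iff)

text \<open>The adjoint of \<open>gain_commute\<close>, since \<open>F\<close> after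
  \<open>adjoint F\<close> and \<open>adjoint F\<close> after \<open>F\<close> are
  self-adjoint.\<close>

lemma adjoint_gain_commute: "adjoint (gain F S) (adjoint F (F x)) = F (adjoint F (adjoint (gain F S) x))"
proof (rule vector_eq_ldot[THEN iffD1], rule allI)
  fix z
  show "z \<bullet> adjoint (gain F S) (adjoint F (F x)) = z \<bullet> F (adjoint F (adjoint (gain F S) x))"
    by (metis adjoint_inner[OF bounded_linear_gain] inner_adjoint inner_commute gain_commute)
qed

text \<open>The closed-loop operator: with the weight at \<open>Suc k\<close> it maps the
  \<open>k\<close>-th output error to the next one.\<close>

definition M :: "'y \<Rightarrow> 'y" where "M e = e - F (gain F S e)"

lemma bounded_linear_M: "bounded_linear M"
  unfolding M_def
  by (intro bounded_linear_sub bounded_linear_ident bounded_linear_compose[OF F] bounded_linear_gain)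

sublocale M': bounded_linear "adjoint M" by (rule bounded_linear_adjoint[OF bounded_linear_M])

lemma M_commute: "M (F (adjoint F e)) = F (adjoint F (M e))"
  by (simp add: M_def gain_commute F.diff F'.diff)

lemma adjoint_M_commute: "adjoint M (F (adjoint F e)) = F (adjoint F (adjoint M e))"
proof (rule vector_eq_ldot[THEN iffD1], rule allI)
  fix z
  show "z \<bullet> adjoint M (F (adjoint F e)) = z \<bullet> F (adjoint F (adjoint M e))"
    by (metis adjoint_inner[OF bounded_linear_M] inner_adjoint inner_commute M_commute)
qed

lemma riccati_step_eq:
  "riccati_step F S e = adjoint M (S (M e)) + adjoint (gain F S) (gain F S e) + e"
  by (simp add: riccati_step_def Let_def M_def[abs_def])

lemma admissible_riccati_step: "admissible F (riccati_step F S)"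
  unfolding admissible_def
proof (intro conjI allI)
  show "bounded_linear (riccati_step F S)"
    unfolding riccati_step_eq[abs_def]
    by (intro bounded_linear_add bounded_linear_ident bounded_linear_gain bounded_linear_M
      bounded_linear_compose[OF M'.bounded_linear_axioms]
      bounded_linear_compose[OF K'.bounded_linear_axioms]
      bounded_linear_compose[OF S.bounded_linear_axioms])
  \<comment> \<open>In this bilinear form symmetry is visible termwise, and the last term alone
    gives the lower bound.\<close>
  have inner: "riccati_step F S a \<bullet> b = S (M a) \<bullet> M b + gain F S a \<bullet> gain F S b + a \<bullet> b" for a b
    unfolding riccati_step_eq inner_add_left
    by (metis inner_commute adjoint_inner[OF bounded_linear_M] adjoint_inner[OF bounded_linear_gain])
  show "riccati_step F S a \<bullet> b = a \<bullet> riccati_step F S b" for a b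
    by (metis inner inner_commute S_sym)
  show "a \<bullet> a \<le> riccati_step F S a \<bullet> a" for a
    using S_ge[of "M a"] inner_ge_zero[of "M a"] inner_ge_zero[of "gain F S a"]
    unfolding inner by linarith
  show "riccati_step F S (F (adjoint F a)) = F (adjoint F (riccati_step F S a))" for a
    by (simp add: riccati_step_eq F.add F'.add M_commute S_commute adjoint_M_commute
        gain_commute adjoint_gain_commute)
qed

text \<open>Here \<open>adjoint F e = 0\<close>, and commutation carries this over to
  \<open>S e\<close>: \<open>F (adjoint F (S e)) = 0\<close>, whose inner product with
  \<open>S e\<close> is the squared norm of \<open>adjoint F (S e)\<close>.\<close>

lemma gain_range_orthogonal:
  assumes "e \<in> (range F)\<^sup>\<bottom>"
  shows "gain F S e = 0"
proof -
  have "F x \<bullet> e = 0" for x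
    using assms by (auto simp: orthogonal_comp_def orthogonal_def)
  then have "adjoint F e = 0"
    by (metis adjoint_inner[OF F] inner_eq_zero_iff)
  then have "F (adjoint F (S e)) = 0"
    using S_commute[of e] by (simp add: F.zero S.zero)
  then have "adjoint F (S e) \<bullet> adjoint F (S e) = 0"
    by (simp add: inner_adjoint)
  then have "H (gain F S e) = H 0"
    by (simp add: H_gain H.zero)
  then show ?thesis by (simp only: H_eq_iff)
qed

end

lemma admissible_riccati:
  fixes F :: "'x::{real_inner,banach} \<Rightarrow> 'y::{real_inner,banach}"
  assumes "bounded_linear F"
  shows "admissible F (riccati F N k)"
  using assms
proof (induction F N k rule: riccati.induct)
  case (1 F N k)
  then show ?case
    by (subst riccati.simps)
      (auto simp: admissible_id intro!: admissible_weight.admissible_riccati_step admissible_weight.intro)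
qed

section \<open>Regularization by slowly growing parameters\<close>

text \<open>The error splits into amplified noise, at most \<open>1 / N \<delta>\<close> by the
  choice of the rule, and the error for the data \<open>y\<close>, which vanishes by pointwise
  convergence.\<close>

lemma tendsto_imp_regularization_operator:
  fixes F :: "'x::real_inner \<Rightarrow> 'y::real_inner"
  assumes R: "\<And>N. bounded_linear (R N)"
    and lim: "\<And>y. y \<in> mp_domain F \<Longrightarrow> (\<lambda>N. R N y) \<longlonglongrightarrow> mp_inverse F y"
  shows "regularization_operator F R"
  unfolding regularization_operator_def
proof (intro conjI allI ballI)
  show "continuous_on UNIV (R N)" for N
    by (rule linear_continuous_on[OF R])
  fix y assume y: "y \<in> mp_domain F"
  \<comment> \<open>The summand 1 gives \<open>real n \<le> g n\<close>, so only finitely many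
    \<open>n\<close> are allowed at each noise level; the norms in the sum give
    \<open>real n * onorm (R n) \<le> g n\<close>, which bounds the noise term.\<close>
  define g where "g n = real n * (1 + (\<Sum>i\<le>n. onorm (R i)))" for n
  have onorm_nonneg: "0 \<le> onorm (R n)" for n by (rule onorm_pos_le[OF R])
  have g_mono: "g m \<le> g n" if "m \<le> n" for m n
    unfolding g_def using that
    by (intro mult_mono add_left_mono sum_mono2 add_nonneg_nonneg sum_nonneg)
      (auto simp: onorm_nonneg)
  have g_ge: "real n \<le> g n" for n
    unfolding g_def by (simp add: mult_le_cancel_left1 sum_nonneg onorm_nonneg)
  have g_onorm: "real n * onorm (R n) \<le> g n" for n
  proof -
    have "onorm (R n) \<le> (\<Sum>i\<le>n. onorm (R i))"
      by (intro member_le_sum) (auto simp: onorm_nonneg)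
    then show ?thesis unfolding g_def by (intro mult_left_mono) auto
  qed
  \<comment> \<open>The largest parameter allowed at noise level \<open>\<delta>\<close>;
    \<open>g 0 = 0\<close> keeps the set nonempty.\<close>
  define N where "N \<delta> = Max {n. g n * \<delta> \<le> 1}" for \<delta>
  have fin: "finite {n. g n * \<delta> \<le> 1}" if "\<delta> > 0" for \<delta>
  proof (rule finite_subset)
    show "{n. g n * \<delta> \<le> 1} \<subseteq> {..nat \<lfloor>1 / \<delta>\<rfloor>}"
    proof clarsimp
      fix n assume "g n * \<delta> \<le> 1"
      then have "real n * \<delta> \<le> 1"
        using mult_right_mono[OF g_ge[of n], of \<delta>] that by linarith
      then have "real n \<le> 1 / \<delta>" using that by (simp add: field_simps)
      then show "n \<le> nat \<lfloor>1 / \<delta>\<rfloor>" by (simp add: le_nat_floor)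
    qed
  qed simp
  have N_le: "g (N \<delta>) * \<delta> \<le> 1" if "\<delta> > 0" for \<delta>
  proof -
    have "0 \<in> {n. g n * \<delta> \<le> 1}" by (simp add: g_def)
    then have "N \<delta> \<in> {n. g n * \<delta> \<le> 1}"
      unfolding N_def using fin[OF that] by (intro Max_in) auto
    then show ?thesis by simp
  qed
  have N_lim: "filterlim N at_top (at_right 0)"
    unfolding filterlim_at_top
  proof
    fix m
    \<comment> \<open>Each fixed \<open>m\<close> enters the set under \<open>Max\<close> once
      \<open>\<delta>\<close> is small.\<close>
    have "((\<lambda>\<delta>. g m * \<delta>) \<longlongrightarrow> g m * 0) (at_right 0)" by (intro tendsto_intros)
    then have "\<forall>\<^sub>F \<delta> in at_right 0. g m * \<delta> < 1" by (intro order_tendstoD) auto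
    then show "\<forall>\<^sub>F \<delta> in at_right 0. m \<le> N \<delta>"
      using eventually_at_right_less[of 0]
      by eventually_elim (auto simp: N_def intro!: Max_ge fin)
  qed
  have bound: "norm (R (N \<delta>) z - mp_inverse F y)
      \<le> inverse (real (N \<delta>)) + norm (R (N \<delta>) y - mp_inverse F y)"
    if "\<delta> > 0" "N \<delta> > 0" "z \<in> cball y \<delta>" for \<delta> z
  proof -
    interpret RN: bounded_linear "R (N \<delta>)" by (rule R)
    have "real (N \<delta>) * (onorm (R (N \<delta>)) * \<delta>) \<le> 1"
      using order_trans[OF mult_right_mono[OF g_onorm less_imp_le[OF that(1)]] N_le[OF that(1)]]
      by (simp add: mult.assoc)
    then have *: "onorm (R (N \<delta>)) * \<delta> \<le> inverse (real (N \<delta>))"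
      using that(2) by (simp add: field_simps)
    have "norm (R (N \<delta>) z - R (N \<delta>) y) \<le> onorm (R (N \<delta>)) * norm (z - y)"
      unfolding RN.diff[symmetric] by (rule onorm[OF R])
    also have "\<dots> \<le> onorm (R (N \<delta>)) * \<delta>"
      using that(3) by (intro mult_left_mono onorm_nonneg) (simp add: dist_norm norm_minus_commute)
    finally show ?thesis
      using * norm_triangle_ineq[of "R (N \<delta>) z - R (N \<delta>) y" "R (N \<delta>) y - mp_inverse F y"]
      by simp
  qed
  show "\<exists>rule. ((\<lambda>\<delta>. SUP z\<in>cball y \<delta>. ereal (norm (R (rule \<delta> z) z - mp_inverse F y)))
            \<longlongrightarrow> 0) (at_right 0) \<and>
        filterlim (\<lambda>\<delta>. INF z\<in>cball y \<delta>. rule \<delta> z) at_top (at_right (0::real))"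
  proof (intro exI[of _ "\<lambda>\<delta> z. N \<delta>"] conjI)
    have pos: "\<forall>\<^sub>F \<delta> in at_right 0. \<delta> > 0 \<and> N \<delta> > 0"
      using eventually_at_right_less[of 0] filterlim_at_top[THEN iffD1, OF N_lim, rule_format, of 1]
      by eventually_elim simp
    show "((\<lambda>\<delta>. SUP z\<in>cball y \<delta>. ereal (norm (R (N \<delta>) z - mp_inverse F y))) \<longlongrightarrow> 0) (at_right 0)"
    proof (rule tendsto_sandwich)
      show "\<forall>\<^sub>F \<delta> in at_right 0. 0 \<le> (SUP z\<in>cball y \<delta>. ereal (norm (R (N \<delta>) z - mp_inverse F y)))"
        using pos by eventually_elim (auto intro!: SUP_upper2[of y])
      show "\<forall>\<^sub>F \<delta> in at_right 0. (SUP z\<in>cball y \<delta>. ereal (norm (R (N \<delta>) z - mp_inverse F y)))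
          \<le> ereal (inverse (real (N \<delta>)) + norm (R (N \<delta>) y - mp_inverse F y))"
        using pos by eventually_elim (auto intro!: SUP_least bound)
      have "(\<lambda>n. inverse (real n) + norm (R n y - mp_inverse F y)) \<longlonglongrightarrow> 0 + norm (mp_inverse F y - mp_inverse F y)"
        by (intro tendsto_intros lim y lim_inverse_n)
      then have "((\<lambda>\<delta>. inverse (real (N \<delta>)) + norm (R (N \<delta>) y - mp_inverse F y)) \<longlongrightarrow> 0) (at_right 0)"
        using filterlim_compose[OF _ N_lim] by fastforce
      then show "((\<lambda>\<delta>. ereal (inverse (real (N \<delta>)) + norm (R (N \<delta>) y - mp_inverse F y))) \<longlongrightarrow> 0) (at_right 0)"
        by (simp add: zero_ereal_def)
    qed simp
    have "\<forall>\<^sub>F \<delta> in at_right 0. N \<delta> = (INF z\<in>cball y \<delta>. N \<delta>)"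
      using eventually_at_right_less[of 0]
      by eventually_elim (simp add: cINF_const)
    then show "filterlim (\<lambda>\<delta>. INF z\<in>cball y \<delta>. N \<delta>) at_top (at_right 0)"
      by (rule filterlim_cong[OF refl refl, THEN iffD1, OF _ N_lim])
  qed
qed

text \<open>Resolves the two descriptions in \<open>mp_inverse\<close>: the range component is
  unique because \<open>range F\<close> meets its orthogonal complement only in 0, and
  \<open>F\<close> is injective on the complement of its kernel.\<close>

lemma mp_domain_decompose:
  fixes F :: "'x::{real_inner,banach} \<Rightarrow> 'y::real_inner"
  assumes F: "bounded_linear F" and y: "y \<in> mp_domain F"
  obtains b where "y = F (mp_inverse F y) + b" "mp_inverse F y \<in> {x. F x = 0}\<^sup>\<bottom>" "b \<in> (range F)\<^sup>\<bottom>"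
proof -
  interpret F: bounded_linear F by fact
  obtain u b where u: "y = F u + b" and b: "b \<in> (range F)\<^sup>\<bottom>"
    using y by (auto simp: mp_domain_def)
  \<comment> \<open>\<open>p\<close> is the kernel component of \<open>u\<close>; removing it leaves
    the preimage of minimal norm.\<close>
  obtain p where p: "F p = 0" "u - p \<in> {x. F x = 0}\<^sup>\<bottom>"
    using orthogonal_projection_exists[OF subspace_zero_set[OF F.linear_axioms] closed_zero_set[OF F]]
    by blast
  have inj: "inj_on F ({x. F x = 0}\<^sup>\<bottom>)"
  proof (rule inj_onI)
    fix v w assume "v \<in> {x. F x = 0}\<^sup>\<bottom>" "w \<in> {x. F x = 0}\<^sup>\<bottom>" "F v = F w"
    then have "F (v - w) = 0" "v - w \<in> {x. F x = 0}\<^sup>\<bottom>"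
      by (auto simp: F.diff intro: subspace_diff[OF subspace_orthogonal_comp])
    then have "(v - w) \<bullet> (v - w) = 0" by (auto simp: orthogonal_comp_def orthogonal_def)
    then show "v = w" by simp
  qed
  have "(THE a. a \<in> range F \<and> y - a \<in> (range F)\<^sup>\<bottom>) = F (u - p)"
  proof (rule the_equality)
    show "F (u - p) \<in> range F \<and> y - F (u - p) \<in> (range F)\<^sup>\<bottom>"
      using u b p by (simp add: F.diff)
    fix a assume a: "a \<in> range F \<and> y - a \<in> (range F)\<^sup>\<bottom>"
    then have "b - (y - a) \<in> (range F)\<^sup>\<bottom>"
      using b by (intro subspace_diff[OF subspace_orthogonal_comp, of b _ "y - a"]) auto
    moreover obtain v where v: "a = F v" using a by blast
    then have "b - (y - a) = F (v - u)" using u by (simp add: F.diff)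
    then have "b - (y - a) \<in> range F" by simp
    ultimately have "(b - (y - a)) \<bullet> (b - (y - a)) = 0"
      unfolding orthogonal_comp_def orthogonal_def by blast
    then have "b = y - a" by (simp only: inner_eq_zero_iff right_minus_eq)
    then show "a = F (u - p)" using u p by (simp add: F.diff)
  qed
  then have "mp_inverse F y = u - p"
    unfolding mp_inverse_def using the_inv_into_f_f[OF inj p(2)] by simp
  then show thesis using u b p by (intro that[of b]) (simp_all add: F.diff)
qed

section \<open>Convergence for exact data\<close>

locale bounded_operator =
  fixes F :: "'x::{real_inner,banach} \<Rightarrow> 'y::{real_inner,banach}"
  assumes F: "bounded_linear F"
begin

sublocale F: bounded_linear F by (rule F)
sublocale F': bounded_linear "adjoint F" by (rule bounded_linear_adjoint[OF F])

text \<open>\<open>W.H N k\<close> is built from the weight with index \<open>k\<close>, so the step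
  from \<open>k\<close> to \<open>Suc k\<close> involves \<open>W.H N (Suc k)\<close>.\<close>

sublocale W: admissible_weight F "riccati F N k" for N k
  by unfold_locales (rule F admissible_riccati[OF F])+

lemma bounded_linear_gain_at: "bounded_linear (gain_at F N k)"
  unfolding gain_at_def[abs_def] by (rule W.bounded_linear_gain)

lemma bounded_linear_out_error: "bounded_linear (\<lambda>y. out_error F N y k)"
proof (induction k)
  case 0
  show ?case by (simp add: bounded_linear_minus bounded_linear_ident)
next
  case (Suc k)
  then show ?case
    by (simp, intro bounded_linear_add bounded_linear_compose[OF F] bounded_linear_minus
        bounded_linear_compose[OF bounded_linear_gain_at])
qed

lemma bounded_linear_final_iterate: "bounded_linear (final_iterate F N)"
  unfolding final_iterate_def[abs_def] control_def
  by (intro bounded_linear_sum bounded_linear_minus bounded_linear_compose[OF bounded_linear_gain_at]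
      bounded_linear_out_error)

lemma out_error_eq: "out_error F N y k = F (\<Sum>j<k. control F N y j) - y"
proof (induction k)
  case (Suc k)
  have "out_error F N y (Suc k) = out_error F N y k + F (control F N y k)"
    by (simp add: control_def)
  then show ?case using Suc by (simp add: F.add del: out_error.simps)
qed (simp add: F.zero)

text \<open>All gains vanish at \<open>- b\<close>, so the output error never leaves its initial
  value and every control is 0.\<close>

lemma final_iterate_range_orthogonal:
  assumes "b \<in> (range F)\<^sup>\<bottom>"
  shows "final_iterate F N b = 0"
proof -
  have "gain_at F N k (- b) = 0" for k
    unfolding gain_at_def
    by (intro W.gain_range_orthogonal subspace_neg[OF subspace_orthogonal_comp] assms)
  moreover from this have "out_error F N b k = - b" for k
    by (induction k) (simp_all add: F.zero)
  ultimately show ?thesis by (simp add: final_iterate_def control_def)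
qed

text \<open>The error of the \<open>k\<close>-th iterate for exact data \<open>F x\<close>. The
  horizon \<open>N\<close> stays an argument because all gains depend on it.\<close>

definition recon_error :: "nat \<Rightarrow> 'x \<Rightarrow> nat \<Rightarrow> 'x" where
  "recon_error N x k = x - (\<Sum>j<k. control F N (F x) j)"

lemma recon_error_0: "recon_error N x 0 = x"
  by (simp add: recon_error_def)

lemma final_iterate_image: "final_iterate F N (F x) = x - recon_error N x N"
  by (simp add: final_iterate_def recon_error_def)

text \<open>An implicit step: the new error is the old error \<open>e\<close> minus the gain applied
  to \<open>F e\<close>. Applying \<open>H\<close> turns the gain into \<open>adjoint F\<close>
  after the weight, which cancels all of \<open>H e\<close> except \<open>e\<close>.\<close>

lemma recon_error_Suc: "W.H N (Suc k) (recon_error N x (Suc k)) = recon_error N x k"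
proof -
  interpret G: bounded_linear "gain_at F N k" by (rule bounded_linear_gain_at)
  have "control F N (F x) k = gain_at F N k (F (recon_error N x k))"
    unfolding control_def[of F N "F x" k] out_error_eq recon_error_def
    by (simp add: F.diff G.diff)
  then have "recon_error N x (Suc k) = recon_error N x k - gain_at F N k (F (recon_error N x k))"
    by (simp add: recon_error_def algebra_simps)
  then have "W.H N (Suc k) (recon_error N x (Suc k)) = W.H N (Suc k) (recon_error N x k)
      - adjoint F (riccati F N (Suc k) (F (recon_error N x k)))"
    by (simp add: gain_at_def W.H.diff W.H_gain)
  then show ?thesis by (simp add: W.H_def)
qed

text \<open>Test the implicit step against the new error and absorb the mixed inner product by
  Cauchy-Schwarz and Young.\<close>

lemma recon_error_energy_step:
  "(norm (recon_error N x (Suc k)))\<^sup>2 + 2 * (norm (F (recon_error N x (Suc k))))\<^sup>2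
    \<le> (norm (recon_error N x k))\<^sup>2"
proof -
  let ?e = "recon_error N x k" and ?e' = "recon_error N x (Suc k)"
  have "(norm ?e')\<^sup>2 + (norm (F ?e'))\<^sup>2 \<le> ?e \<bullet> ?e'"
    using W.H_inner[of ?e' N "Suc k"] by (simp only: recon_error_Suc)
  also have "2 * (?e \<bullet> ?e') \<le> (norm ?e)\<^sup>2 + (norm ?e')\<^sup>2"
    using norm_cauchy_schwarz[of ?e ?e'] sum_squares_bound[of "norm ?e" "norm ?e'"] by simp
  ultimately show ?thesis by linarith
qed

lemma recon_error_antimono:
  assumes "j \<le> k"
  shows "norm (recon_error N x k) \<le> norm (recon_error N x j)"
  using assms
proof (induction rule: dec_induct)
  case (step k)
  have "(norm (recon_error N x (Suc k)))\<^sup>2 \<le> (norm (recon_error N x k))\<^sup>2"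
    using recon_error_energy_step[of N x k] zero_le_power2[of "norm (F (recon_error N x (Suc k)))"]
    by linarith
  then show ?case using step.IH power2_le_imp_le by fastforce
qed simp

lemma recon_error_energy:
  "(norm (recon_error N x k))\<^sup>2 + 2 * (\<Sum>j<k. (norm (F (recon_error N x (Suc j))))\<^sup>2) \<le> (norm x)\<^sup>2"
proof (induction k)
  case (Suc k)
  then show ?case using recon_error_energy_step[of N x k] by (simp add: algebra_simps)
qed (simp add: recon_error_0)

text \<open>Both sides solve the same recursion from the same initial value, as \<open>H\<close> is
  injective and commutes with \<open>adjoint F\<close> after \<open>F\<close>.\<close>

lemma recon_error_commute:
  "recon_error N (adjoint F (F z)) k = adjoint F (F (recon_error N z k))"
proof (induction k)
  case (Suc k)
  have "W.H N (Suc k) (recon_error N (adjoint F (F z)) (Suc k))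
      = W.H N (Suc k) (adjoint F (F (recon_error N z (Suc k))))"
    by (simp only: recon_error_Suc W.H_commute Suc)
  then show ?case by (simp only: W.H_eq_iff)
qed (simp add: recon_error_0)

text \<open>The last error is the smallest, so \<open>N\<close> times its square is at most the sum
  of all squares; by commutation this sum is controlled by the energy bound for \<open>z\<close>,
  uniformly in \<open>N\<close>.\<close>

lemma recon_error_normal_range_tendsto:
  "(\<lambda>N. recon_error N (adjoint F (F z)) N) \<longlonglongrightarrow> 0"
proof -
  obtain B where B: "B > 0" "\<And>y. norm (adjoint F y) \<le> norm y * B"
    using F'.pos_bounded by blast
  let ?e = "\<lambda>N. recon_error N (adjoint F (F z))"
  have bound: "(norm (?e N N))\<^sup>2 \<le> (B * norm z)\<^sup>2 * inverse (real N)" if "N > 0" for N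
  proof -
    have "real N * (norm (?e N N))\<^sup>2 = (\<Sum>j<N. (norm (?e N N))\<^sup>2)" by simp
    also have "\<dots> \<le> (\<Sum>j<N. B\<^sup>2 * (norm (F (recon_error N z (Suc j))))\<^sup>2)"
    proof (rule sum_mono)
      fix j assume "j \<in> {..<N}"
      then have "norm (?e N N) \<le> norm (?e N (Suc j))" by (intro recon_error_antimono) auto
      also have "\<dots> \<le> norm (F (recon_error N z (Suc j))) * B"
        unfolding recon_error_commute by (rule B)
      finally have "(norm (?e N N))\<^sup>2 \<le> (norm (F (recon_error N z (Suc j))) * B)\<^sup>2"
        by (intro power_mono) auto
      then show "(norm (?e N N))\<^sup>2 \<le> B\<^sup>2 * (norm (F (recon_error N z (Suc j))))\<^sup>2"
        by (simp add: power_mult_distrib mult.commute)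
    qed
    also have "\<dots> \<le> B\<^sup>2 * (norm z)\<^sup>2"
      unfolding sum_distrib_left[symmetric]
    proof (intro mult_left_mono)
      \<comment> \<open>Nonnegativity lets the factor 2 of the energy bound be dropped.\<close>
      have "0 \<le> (\<Sum>j<N. (norm (F (recon_error N z (Suc j))))\<^sup>2)" by (intro sum_nonneg) simp
      then show "(\<Sum>j<N. (norm (F (recon_error N z (Suc j))))\<^sup>2) \<le> (norm z)\<^sup>2"
        using recon_error_energy[of N z N] zero_le_power2[of "norm (recon_error N z N)"] by linarith
    qed simp
    finally show ?thesis using that by (simp add: field_simps)
  qed
  have "(\<lambda>N. (norm (?e N N))\<^sup>2) \<longlonglongrightarrow> 0"
  proof (rule tendsto_sandwich[where f = "\<lambda>_. 0"])
    show "\<forall>\<^sub>F N in sequentially. (norm (?e N N))\<^sup>2 \<le> (B * norm z)\<^sup>2 * inverse (real N)"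
      using eventually_gt_at_top[of 0] by eventually_elim (rule bound)
    show "(\<lambda>N. (B * norm z)\<^sup>2 * inverse (real N)) \<longlonglongrightarrow> 0"
      by (intro tendsto_mult_right_zero lim_inverse_n)
  qed auto
  then show ?thesis by (simp add: tendsto_norm_zero_iff)
qed

lemma recon_error_diff: "recon_error N (x - z) N = recon_error N x N - recon_error N z N"
proof -
  have "recon_error N x N = x - final_iterate F N (F x)" for x
    by (simp add: final_iterate_image)
  then show ?thesis
    by (simp add: F.diff bounded_linear.linear[OF bounded_linear_final_iterate, THEN linear_diff])
qed

text \<open>A vector \<open>w\<close> orthogonal to this range has \<open>F w = 0\<close>, because
  \<open>adjoint F (F w) \<bullet> w\<close> is the squared norm of \<open>F w\<close>. Hence the
  complement of the kernel lies in the double complement of the range.\<close>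

lemma normal_range_dense:
  assumes "x \<in> {x. F x = 0}\<^sup>\<bottom>"
  shows "x \<in> closure (range (\<lambda>z. adjoint F (F z)))"
proof (rule orthogonal_comp_double_closure)
  have "linear (\<lambda>z. adjoint F (F z))"
    using linear_compose[OF F.linear_axioms F'.linear_axioms] by (simp add: comp_def)
  then show "subspace (range (\<lambda>z. adjoint F (F z)))"
    by (intro linear_subspace_image subspace_UNIV)
  have "F w = 0" if "w \<in> (range (\<lambda>z. adjoint F (F z)))\<^sup>\<bottom>" for w
  proof -
    have "adjoint F (F w) \<bullet> w = 0" using that by (auto simp: orthogonal_comp_def orthogonal_def)
    then show ?thesis by (metis adjoint_inner[OF F] inner_commute inner_eq_zero_iff)
  qed
  then show "x \<in> (range (\<lambda>z. adjoint F (F z)))\<^sup>\<bottom>\<^sup>\<bottom>"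
    using assms unfolding orthogonal_comp_def[of "_\<^sup>\<bottom>"] orthogonal_comp_def[of "{x. F x = 0}"] by blast
qed

text \<open>Density argument: approximate \<open>x\<close> by some \<open>adjoint F (F z)\<close>;
  the error of the difference never exceeds its initial norm, whatever \<open>N\<close> is.\<close>

lemma recon_error_tendsto:
  assumes "x \<in> {x. F x = 0}\<^sup>\<bottom>"
  shows "(\<lambda>N. recon_error N x N) \<longlonglongrightarrow> 0"
proof (rule LIMSEQ_I)
  fix r :: real assume r: "r > 0"
  obtain z where z: "dist (adjoint F (F z)) x < r / 2"
    using normal_range_dense[OF assms] r by (auto simp: closure_approachable dest: spec[of _ "r / 2"])
  let ?a = "adjoint F (F z)"
  obtain n0 where n0: "\<And>N. N \<ge> n0 \<Longrightarrow> norm (recon_error N ?a N) < r / 2"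
    using LIMSEQ_D[OF recon_error_normal_range_tendsto[of z], of "r / 2"] r by auto
  have "norm (recon_error N x N) < r" if "N \<ge> n0" for N
  proof -
    have "recon_error N x N = recon_error N (x - ?a) N + recon_error N ?a N"
      by (simp add: recon_error_diff)
    moreover have "norm (recon_error N (x - ?a) N) \<le> norm (x - ?a)"
      using recon_error_antimono[of 0 N N "x - ?a"] by (simp add: recon_error_0)
    ultimately show ?thesis
      using norm_triangle_ineq[of "recon_error N (x - ?a) N" "recon_error N ?a N"] n0[OF that] z
      by (simp add: dist_norm norm_minus_commute)
  qed
  then show "\<exists>n0. \<forall>N\<ge>n0. norm (recon_error N x N - 0) < r" by auto
qed

text \<open>The component of \<open>y\<close> orthogonal to the range contributes nothing, which
  leaves exact data generated by \<open>mp_inverse F y\<close>.\<close>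

lemma final_iterate_tendsto:
  assumes "y \<in> mp_domain F"
  shows "(\<lambda>N. final_iterate F N y) \<longlonglongrightarrow> mp_inverse F y"
proof -
  obtain b where y: "y = F (mp_inverse F y) + b" and u: "mp_inverse F y \<in> {x. F x = 0}\<^sup>\<bottom>"
    and b: "b \<in> (range F)\<^sup>\<bottom>"
    using mp_domain_decompose[OF F assms] by blast
  have "final_iterate F N y = mp_inverse F y - recon_error N (mp_inverse F y) N" for N
  proof -
    have "final_iterate F N y = final_iterate F N (F (mp_inverse F y)) + final_iterate F N b"
      using y bounded_linear.linear[OF bounded_linear_final_iterate, THEN linear_add] by metis
    then show ?thesis by (simp add: final_iterate_range_orthogonal[OF b] final_iterate_image)
  qed
  then show ?thesis
    using tendsto_diff[OF tendsto_const recon_error_tendsto[OF u], of "mp_inverse F y"] by simp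
qed

end

theorem theorem3p5:
  fixes F :: "'x::{real_inner,banach} \<Rightarrow> 'y::{real_inner,banach}"
  assumes "bounded_linear F"
  shows "regularization_operator F (final_iterate F)"
proof -
  interpret bounded_operator F by (rule bounded_operator.intro[OF assms])
  show ?thesis
    by (intro tendsto_imp_regularization_operator bounded_linear_final_iterate final_iterate_tendsto)
qed

end
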